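(* Let $(S,\mathcal C)$ be a connected connectoid, and for every end $\omega\in\Omega(S,\mathcal C)$ let $X_\omega\subseteq S$ be a finite set; put $\mathcal K^*=\{K(X_\omega,\omega):\omega\in\Omega(S,\mathcal C)\}$. Then there is a rayless normal tree $T$ of $(S,\mathcal C)$ such that every element of $\mathcal K(S\setminus V(T))$ is a subset of some element of $\mathcal K^*$.
   Context: A connectoid is given by a set $S$ and a set $\mathcal F$ of finite subsets of $S$ such that (i) $F\cup F'\in\mathcal F$ whenever $F,F'\in\mathcal F$ and $F\cap F'\neq\emptyset$, and (ii) $\emptyset\in\mathcal F$ and $\{s\}\in\mathcal F$ for every $s\in S$. A set $C\subseteq S$ is connected if for all $x,y\in C$ there is $F\in\mathcal F$ with $F\subseteq C$ and $x,y\in F$; $\mathcal C$ is the set of connected sets and $(S,\mathcal C)$ is the connectoid. It is connected if $S\in\mathcal C$. For $S'\subseteq S$, a component of $S'$ is a maximal connected subset of $S'$, and $\mathcal K(S')$ is the set of components of $S'$. "Almost all" means all but finitely many. A necklace is a connected set $N$ for which there is a family $(H_n)_{n\in\mathbb N}$ of finite connected sets with $N=\bigcup_n H_n$ and $H_i\cap H_j\neq\emptyset$ iff $|i-j|\le 1$. For a necklace $N$ and finite $X\subseteq S$, the $X$-tail of $N$ is the unique element of $\mathcal K(N\setminus X)$ containing almost all elements of $N$. Two necklaces are equivalent if for every finite $X\subseteq S$ their $X$-tails lie in the same element of $\mathcal K(S\setminus X)$. An end is an equivalence class of necklaces; $\Omega(S,\mathcal C)$ is the set of ends; $K(X,\omega)$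 is the element of $\mathcal K(S\setminus X)$ containing the $X$-tails of all necklaces in $\omega$. For a rooted tree $T$ with tree order $\le_T$ and $t\in V(T)$, let $\mathrm{Down}^\circ_T(t)=\{x\in V(T):x<_T t\}$. A weak normal tree of $(S,\mathcal C)$ is a rooted undirected tree $T$ with $V(T)\subseteq S$ such that (1) for every $C\in\mathcal C$ and every two $\le_T$-incomparable $u,v\in C\cap V(T)$ there is $w\in C$ with $w\le_T u$ and $w\le_T v$, and (2) for all $u\le_T v$ in $V(T)$ there is $C\in\mathcal C$ containing $u,v$ with $C\cap\mathrm{Down}^\circ_T(u)=\emptyset$. It is a normal tree if additionally for every rooted ray $R$ of $T$ there is a necklace containing almost all vertices of $R$. A tree is rayless if it contains no ray. *)

theory Defs
  imports Main
begin

definition connectoid :: "'a set \<Rightarrow> 'a set set \<Rightarrow> bool" where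
  "connectoid S \<F> \<longleftrightarrow>
     (\<forall>F\<in>\<F>. finite F \<and> F \<subseteq> S) \<and>
     (\<forall>F\<in>\<F>. \<forall>F'\<in>\<F>. F \<inter> F' \<noteq> {} \<longrightarrow> F \<union> F' \<in> \<F>) \<and>
     {} \<in> \<F> \<and> (\<forall>s\<in>S. {s} \<in> \<F>)"

definition conn :: "'a set \<Rightarrow> 'a set set \<Rightarrow> 'a set \<Rightarrow> bool" where
  "conn S \<F> C \<longleftrightarrow> C \<subseteq> S \<and> (\<forall>x\<in>C. \<forall>y\<in>C. \<exists>F\<in>\<F>. F \<subseteq> C \<and> x \<in> F \<and> y \<in> F)"

definition connected_connectoid :: "'a set \<Rightarrow> 'a set set \<Rightarrow> bool" where
  "connected_connectoid S \<F> \<longleftrightarrow> conn S \<F> S"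

definition comps :: "'a set \<Rightarrow> 'a set set \<Rightarrow> 'a set \<Rightarrow> 'a set set" where
  "comps S \<F> S' = {C. C \<noteq> {} \<and> C \<subseteq> S' \<and> conn S \<F> C \<and>
                        (\<forall>D. C \<subseteq> D \<and> D \<subseteq> S' \<and> conn S \<F> D \<longrightarrow> D = C)}"

definition necklace :: "'a set \<Rightarrow> 'a set set \<Rightarrow> 'a set \<Rightarrow> bool" where
  "necklace S \<F> N \<longleftrightarrow> conn S \<F> N \<and>
     (\<exists>H :: nat \<Rightarrow> 'a set. (\<forall>n. finite (H n) \<and> conn S \<F> (H n)) \<and> N = (\<Union>n. H n) \<and>
        (\<forall>i j. H i \<inter> H j \<noteq> {} \<longleftrightarrow> (i \<le> j + 1 \<and> j \<le> i + 1)))"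

definition tail :: "'a set \<Rightarrow> 'a set set \<Rightarrow> 'a set \<Rightarrow> 'a set \<Rightarrow> 'a set" where
  "tail S \<F> X N = (THE C. C \<in> comps S \<F> (N - X) \<and> finite (N - C))"

definition neck_equiv :: "'a set \<Rightarrow> 'a set set \<Rightarrow> 'a set \<Rightarrow> 'a set \<Rightarrow> bool" where
  "neck_equiv S \<F> N N' \<longleftrightarrow>
     (\<forall>X. finite X \<and> X \<subseteq> S \<longrightarrow>
        (\<exists>K\<in>comps S \<F> (S - X). tail S \<F> X N \<subseteq> K \<and> tail S \<F> X N' \<subseteq> K))"

definition ends :: "'a set \<Rightarrow> 'a set set \<Rightarrow> 'a set set set" where
  "ends S \<F> = {\<omega>. \<exists>N. necklace S \<F> N \<and> \<omega> = {N'. necklace S \<F> N' \<and> neck_equiv S \<F> N N'}}"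

definition endK :: "'a set \<Rightarrow> 'a set set \<Rightarrow> 'a set \<Rightarrow> 'a set set \<Rightarrow> 'a set" where
  "endK S \<F> X \<omega> = (THE K. K \<in> comps S \<F> (S - X) \<and> (\<forall>N\<in>\<omega>. tail S \<F> X N \<subseteq> K))"

definition is_graph :: "'a set \<Rightarrow> 'a set set \<Rightarrow> bool" where
  "is_graph V E \<longleftrightarrow> (\<forall>e\<in>E. \<exists>u v. e = {u, v} \<and> u \<noteq> v \<and> u \<in> V \<and> v \<in> V)"

definition is_path :: "'a set \<Rightarrow> 'a set set \<Rightarrow> 'a list \<Rightarrow> bool" where
  "is_path V E p \<longleftrightarrow> p \<noteq> [] \<and> distinct p \<and> set p \<subseteq> V \<and>
     (\<forall>i. Suc i < length p \<longrightarrow> {p ! i, p ! Suc i} \<in> E)"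

definition is_tree :: "'a set \<Rightarrow> 'a set set \<Rightarrow> bool" where
  "is_tree V E \<longleftrightarrow> is_graph V E \<and> V \<noteq> {} \<and>
     (\<forall>u\<in>V. \<forall>v\<in>V. \<exists>p. is_path V E p \<and> hd p = u \<and> last p = v) \<and>
     \<not> (\<exists>p. is_path V E p \<and> 3 \<le> length p \<and> {last p, hd p} \<in> E)"

definition rooted_tree :: "'a set \<Rightarrow> 'a set set \<Rightarrow> 'a \<Rightarrow> bool" where
  "rooted_tree V E r \<longleftrightarrow> is_tree V E \<and> r \<in> V"

definition tree_le :: "'a set \<Rightarrow> 'a set set \<Rightarrow> 'a \<Rightarrow> 'a \<Rightarrow> 'a \<Rightarrow> bool" where
  "tree_le V E r x y \<longleftrightarrow> x \<in> V \<and> y \<in> V \<and>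
     (\<forall>p. is_path V E p \<and> hd p = r \<and> last p = y \<longrightarrow> x \<in> set p)"

definition down_open :: "'a set \<Rightarrow> 'a set set \<Rightarrow> 'a \<Rightarrow> 'a \<Rightarrow> 'a set" where
  "down_open V E r t = {x \<in> V. tree_le V E r x t \<and> x \<noteq> t}"

definition is_ray :: "'a set \<Rightarrow> 'a set set \<Rightarrow> (nat \<Rightarrow> 'a) \<Rightarrow> bool" where
  "is_ray V E R \<longleftrightarrow> inj R \<and> (\<forall>n. R n \<in> V \<and> {R n, R (Suc n)} \<in> E)"

definition rayless :: "'a set \<Rightarrow> 'a set set \<Rightarrow> bool" where
  "rayless V E \<longleftrightarrow> \<not> (\<exists>R. is_ray V E R)"

definition weak_normal_tree :: "'a set \<Rightarrow> 'a set set \<Rightarrow> 'a set \<Rightarrow> 'a set set \<Rightarrow> 'a \<Rightarrow> bool" where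
  "weak_normal_tree S \<F> V E r \<longleftrightarrow> rooted_tree V E r \<and> V \<subseteq> S \<and>
     (\<forall>C. conn S \<F> C \<longrightarrow> (\<forall>u\<in>C \<inter> V. \<forall>v\<in>C \<inter> V.
         \<not> tree_le V E r u v \<and> \<not> tree_le V E r v u \<longrightarrow>
         (\<exists>w\<in>C. tree_le V E r w u \<and> tree_le V E r w v))) \<and>
     (\<forall>u\<in>V. \<forall>v\<in>V. tree_le V E r u v \<longrightarrow>
         (\<exists>C. conn S \<F> C \<and> u \<in> C \<and> v \<in> C \<and> C \<inter> down_open V E r u = {}))"

definition normal_tree :: "'a set \<Rightarrow> 'a set set \<Rightarrow> 'a set \<Rightarrow> 'a set set \<Rightarrow> 'a \<Rightarrow> bool" where
  "normal_tree S \<F> V E r \<longleftrightarrow> weak_normal_tree S \<F> V E r \<and>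
     (\<forall>R. is_ray V E R \<and> R 0 = r \<longrightarrow>
        (\<exists>N. necklace S \<F> N \<and> finite (range R - N)))"

end

theory Submission
  imports Defs
begin

text \<open>
  Call a connected set dismantlable if it lies inside some element of \<open>\<K>\<^sup>*\<close>, or if removing a
  suitable point leaves only dismantlable components. Recording the removed points of a
  dismantlable set, each below everything removed later inside its component, yields the tree order
  of a rayless normal tree. So it remains to exclude bad, that is non-dismantlable, connected sets.

  Removing finitely many points from a bad set leaves a bad subset. A sequence of bad sets
  \<open>C\<^sub>0 \<supseteq> C\<^sub>1 \<supseteq> \<dots>\<close>, in which the finite sets removed are linked by finite connected sets, carries a
  necklace, hence an end \<open>\<omega>\<close>; let \<open>X = X\<^sub>\<omega>\<close>. For large \<open>n\<close>, the part of \<open>X\<close> in \<open>C\<^sub>n\<close> lies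
  in all \<open>C\<^sub>i\<close>, and it separates, within \<open>C\<^sub>n\<close>, the points removed at stage \<open>n\<close> from everything outside
  \<open>K(X, \<omega>)\<close>. Consequently some bad \<open>C\<close> has the following property: for all finite \<open>Z \<subseteq> C\<close> and
  bad \<open>D \<subseteq> C - Z\<close> there is a finite \<open>Y \<subseteq> D\<close> such that the component of \<open>C - Y\<close> containing
  \<open>Z\<close> lies inside an element of \<open>\<K>\<^sup>*\<close>; so \<open>Y\<close> separates \<open>Z\<close> from every bad subset of \<open>D - Y\<close>.
  Starting from this \<open>C\<close>, choose the sequence such that each step separates all points
  removed so far from the next bad set. A point \<open>y\<close> of \<open>\<Inter>\<^sub>n C\<^sub>n\<close> would be joined in \<open>C\<close>
  to a removed point by a finite connected set \<open>F\<close>, which a separator chosen after the last removed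
  point of \<open>F\<close> would miss. Hence \<open>\<Inter>\<^sub>n C\<^sub>n = \<emptyset>\<close>, so \<open>C\<^sub>n\<close> avoids \<open>X\<close> for large \<open>n\<close>
  and lies inside \<open>K(X, \<omega>)\<close>: it is not bad after all.
\<close>

text \<open>Each point of \<open>X\<close> outside the intersection is missing from some
  \<open>C n\<close>, and finitely many such stages have a maximum. Applied to
  \<open>X \<omega>\<close>, this leaves only permanent points of the sequence.\<close>

lemma decreasing_eventually_Inter:
  fixes C :: "nat \<Rightarrow> 'b set"
  assumes "finite X" "\<And>n. C (Suc n) \<subseteq> C n"
  shows "\<exists>n. X \<inter> C n \<subseteq> \<Inter>(range C)"
proof -
  have "\<exists>n. x \<in> C n \<longrightarrow> x \<in> \<Inter>(range C)" for x
    by blast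
  then obtain f where f: "\<And>x. x \<in> C (f x) \<longrightarrow> x \<in> \<Inter>(range C)"
    by metis
  define n where "n = Max (insert 0 (f ` X))"
  have "C n \<subseteq> C (f x)" if "x \<in> X" for x
  proof (rule lift_Suc_antimono_le[of C, OF assms(2)])
    show "f x \<le> n"
      using assms(1) that unfolding n_def by simp
  qed
  then show ?thesis
    using f by blast
qed

section \<open>Connected sets and components\<close>

locale connectoid_on =
  fixes S :: "'a set" and \<F> :: "'a set set"
  assumes connectoid: "connectoid S \<F>"
begin

lemma conn_subset: "conn S \<F> C \<Longrightarrow> C \<subseteq> S"
  by (simp add: conn_def)

lemma conn_member: "F \<in> \<F> \<Longrightarrow> conn S \<F> F"
  using connectoid unfolding conn_def connectoid_def by blast

lemma finite_member: "F \<in> \<F> \<Longrightarrow> finite F"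
  using connectoid unfolding connectoid_def by blast

lemma conn_obtain:
  assumes "conn S \<F> C" "x \<in> C" "y \<in> C"
  obtains F where "finite F" "conn S \<F> F" "F \<subseteq> C" "x \<in> F" "y \<in> F"
proof -
  obtain F where "F \<in> \<F>" "F \<subseteq> C" "x \<in> F" "y \<in> F"
    using assms unfolding conn_def by blast
  then show thesis
    using that[of F] conn_member[of F] finite_member[of F] by blast
qed

text \<open>The finite witnesses joining \<open>y\<close> and \<open>z\<close> to the common point
  \<open>x\<close> meet in \<open>x\<close>, so the union axiom for \<open>\<F>\<close> merges
  them.\<close>

lemma conn_Union:
  assumes "\<And>D. D \<in> \<D> \<Longrightarrow> conn S \<F> D" "\<And>D. D \<in> \<D> \<Longrightarrow> x \<in> D"
  shows "conn S \<F> (\<Union>\<D>)"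
  unfolding conn_def
proof (intro conjI ballI)
  show "\<Union>\<D> \<subseteq> S"
    using assms(1) conn_subset by blast
next
  fix y z assume "y \<in> \<Union>\<D>" "z \<in> \<Union>\<D>"
  then obtain D E where D: "D \<in> \<D>" "y \<in> D" and E: "E \<in> \<D>" "z \<in> E"
    by blast
  obtain F where F: "F \<in> \<F>" "F \<subseteq> D" "y \<in> F" "x \<in> F"
    using assms D unfolding conn_def by meson
  obtain G where G: "G \<in> \<F>" "G \<subseteq> E" "z \<in> G" "x \<in> G"
    using assms E unfolding conn_def by meson
  have "F \<union> G \<in> \<F>"
    using connectoid F(1,4) G(1,4) unfolding connectoid_def by blast
  then show "\<exists>F\<in>\<F>. F \<subseteq> \<Union>\<D> \<and> y \<in> F \<and> z \<in> F"
    using F G D E by (intro bexI[of _ "F \<union> G"]) auto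
qed

lemma conn_Un:
  assumes "conn S \<F> C" "conn S \<F> D" "C \<inter> D \<noteq> {}"
  shows "conn S \<F> (C \<union> D)"
proof -
  obtain x where "x \<in> C" "x \<in> D"
    using assms(3) by blast
  then have "conn S \<F> (\<Union>{C, D})"
    using assms(1,2) by (intro conn_Union[where x = x]) auto
  then show ?thesis
    by simp
qed

text \<open>By \<open>conn_Union\<close>, the union of all connected subsets of \<open>A\<close>
  through one point of \<open>D\<close> is connected, hence the largest of them and a
  component.\<close>

lemma ex_comps_superset:
  assumes "conn S \<F> D" "D \<noteq> {}" "D \<subseteq> A"
  shows "\<exists>C\<in>comps S \<F> A. D \<subseteq> C"
proof -
  obtain x where x: "x \<in> D"
    using assms(2) by blast
  define C where "C = \<Union>{E. conn S \<F> E \<and> E \<subseteq> A \<and> x \<in> E}"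
  have C: "conn S \<F> C"
    unfolding C_def by (rule conn_Union) auto
  have "D \<subseteq> C"
    using assms x unfolding C_def by blast
  moreover have "E = C" if "C \<subseteq> E" "E \<subseteq> A" "conn S \<F> E" for E
  proof
    have "x \<in> E"
      using that(1) x \<open>D \<subseteq> C\<close> by blast
    then show "E \<subseteq> C"
      using that unfolding C_def by blast
  qed (rule that(1))
  moreover have "C \<subseteq> A"
    unfolding C_def by blast
  ultimately have "C \<in> comps S \<F> A"
    using C assms(2) unfolding comps_def by auto
  then show ?thesis
    using \<open>D \<subseteq> C\<close> by blast
qed

lemma comps_conn: "C \<in> comps S \<F> A \<Longrightarrow> conn S \<F> C"
  and comps_subset: "C \<in> comps S \<F> A \<Longrightarrow> C \<subseteq> A"
  and comps_nonempty: "C \<in> comps S \<F> A \<Longrightarrow> C \<noteq> {}"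
  unfolding comps_def by auto

lemma comps_absorb:
  assumes "C \<in> comps S \<F> A" "conn S \<F> D" "D \<subseteq> A" "C \<inter> D \<noteq> {}"
  shows "D \<subseteq> C"
proof -
  have "conn S \<F> (C \<union> D)"
    using assms comps_conn conn_Un by blast
  then have "C \<union> D = C"
    using assms(1,3) unfolding comps_def by blast
  then show ?thesis
    by blast
qed

lemma comps_eq:
  assumes "C \<in> comps S \<F> A" "D \<in> comps S \<F> A" "C \<inter> D \<noteq> {}"
  shows "C = D"
  using comps_absorb[OF assms(1)] comps_absorb[OF assms(2)] assms comps_conn comps_subset
  by (metis inf_commute subset_antisym)

lemma finite_conn_superset:
  assumes "conn S \<F> C" "finite P" "P \<subseteq> C"
  obtains G where "finite G" "conn S \<F> G" "P \<subseteq> G" "G \<subseteq> C"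
proof (cases "P = {}")
  case True
  then show thesis
    using that[of "{}"] by (simp add: conn_def)
next
  case False
  then obtain x where x: "x \<in> P"
    by blast
  have "\<forall>y\<in>P. \<exists>F. finite F \<and> conn S \<F> F \<and> F \<subseteq> C \<and> x \<in> F \<and> y \<in> F"
    using assms x by (meson conn_obtain subsetD)
  then obtain F where F: "\<forall>y\<in>P. finite (F y) \<and> conn S \<F> (F y) \<and> F y \<subseteq> C \<and> x \<in> F y \<and> y \<in> F y"
    by metis
  show thesis
  proof (rule that[of "\<Union>(F ` P)"])
    show "conn S \<F> (\<Union>(F ` P))"
      using F by (intro conn_Union[where x = x]) auto
  qed (use F assms(2) in auto)
qed

section \<open>Necklaces and ends\<close>

text \<open>Finite blocks starting at \<open>m\<close> are connected by induction, and all of them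
  share a point of \<open>H m\<close>, so \<open>conn_Union\<close> settles the infinite
  union.\<close>

lemma conn_chain:
  fixes H :: "nat \<Rightarrow> 'a set"
  assumes "\<And>n. conn S \<F> (H n)" "\<And>n. H n \<inter> H (Suc n) \<noteq> {}"
  shows "conn S \<F> (\<Union>n\<in>{m..}. H n)"
proof -
  have U: "conn S \<F> (\<Union>n\<in>{m..m+k}. H n)" for k
  proof (induction k)
    case 0
    then show ?case
      using assms by simp
  next
    case (Suc k)
    have eq: "(\<Union>n\<in>{m..m + Suc k}. H n) = (\<Union>n\<in>{m..m+k}. H n) \<union> H (Suc (m + k))"
      by (auto simp: atLeastAtMostSuc_conv)
    have "m + k \<in> {m..m+k}"
      by simp
    then have "(\<Union>n\<in>{m..m+k}. H n) \<inter> H (Suc (m + k)) \<noteq> {}"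
      using assms(2)[of "m + k"] by blast
    then show ?case
      unfolding eq using Suc assms(1) by (intro conn_Un)
  qed
  obtain x where x: "x \<in> H m"
    using assms(2)[of m] by blast
  have "(\<Union>n\<in>{m..}. H n) = \<Union>(range (\<lambda>k. \<Union>n\<in>{m..m+k}. H n))" (is "?L = ?R")
  proof
    show "?L \<subseteq> ?R"
    proof
      fix y assume "y \<in> ?L"
      then obtain n where "n \<ge> m" "y \<in> H n"
        by auto
      then have "y \<in> (\<Union>i\<in>{m..m+(n-m)}. H i)"
        by auto
      then show "y \<in> ?R"
        by blast
    qed
  qed auto
  moreover have "x \<in> (\<Union>n\<in>{m..m+k}. H n)" for k
    using x by (intro UN_I[of m]) auto
  then have "conn S \<F> ?R"
    using U by (intro conn_Union[where x = x]) blast+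
  ultimately show ?thesis
    by simp
qed

text \<open>Justifies the \<open>THE\<close> in \<open>tail\<close>. A finite \<open>X\<close>
  misses all \<open>H k\<close> from some index on, so the rest of the chain lies in one component,
  which omits only finitely many points of \<open>N\<close>; two such components meet because
  \<open>N\<close> is infinite.\<close>

lemma necklace_tail:
  assumes N: "necklace S \<F> N" and X: "finite X"
  shows "tail S \<F> X N \<in> comps S \<F> (N - X)" "finite (N - tail S \<F> X N)" "infinite N"
proof -
  have "\<exists>H :: nat \<Rightarrow> 'a set. (\<forall>n. finite (H n) \<and> conn S \<F> (H n)) \<and> N = (\<Union>n. H n) \<and>
      (\<forall>i j. H i \<inter> H j \<noteq> {} \<longleftrightarrow> i \<le> j + 1 \<and> j \<le> i + 1)"
    using N unfolding necklace_def by (rule conjunct2)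
  then obtain H :: "nat \<Rightarrow> 'a set" where "(\<forall>n. finite (H n) \<and> conn S \<F> (H n)) \<and> N = (\<Union>n. H n) \<and>
      (\<forall>i j. H i \<inter> H j \<noteq> {} \<longleftrightarrow> i \<le> j + 1 \<and> j \<le> i + 1)"
    by (rule exE)
  then have H: "\<And>n. finite (H n)" "\<And>n. conn S \<F> (H n)" "N = (\<Union>n. H n)"
    "\<And>i j. H i \<inter> H j \<noteq> {} \<longleftrightarrow> i \<le> j + 1 \<and> j \<le> i + 1"
    by simp_all
  have nonempty: "H n \<noteq> {}" for n
    using H(4)[of n n] by auto
  have disj: "H i \<inter> H j = {}" if "i + 1 < j" for i j
    using H(4)[of i j] that by auto
  show inf: "infinite N"
  proof
    assume "finite N"
    define f where "f n = (SOME x. x \<in> H (2 * n))" for n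
    have f: "f n \<in> H (2 * n)" for n
      unfolding f_def using nonempty by (simp add: some_in_eq)
    have "f m \<noteq> f n" if "m < n" for m n
      using f[of m] f[of n] disj[of "2 * m" "2 * n"] that by auto
    then have "inj f"
      by (metis injI linorder_neqE_nat)
    moreover have "range f \<subseteq> N"
      using f H(3) by auto
    ultimately show False
      using \<open>finite N\<close> finite_subset finite_imageD infinite_UNIV_nat by blast
  qed
  have "\<exists>n. \<forall>k\<ge>n. x \<notin> H k" for x
  proof (cases "\<exists>n. x \<in> H n")
    case True
    then obtain n where n: "x \<in> H n"
      by blast
    then show ?thesis
      using disj[of n] by (intro exI[of _ "n + 2"]) (auto simp: disjoint_iff)
  qed auto
  then obtain b where b: "\<And>x k. k \<ge> b x \<Longrightarrow> x \<notin> H k"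
    by metis
  define m where "m = Max (insert 0 (b ` X))"
  have m: "x \<notin> H k" if "x \<in> X" "k \<ge> m" for x k
    using b[of x k] that Max_ge[of "insert 0 (b ` X)" "b x"] X unfolding m_def by force
  define U where "U = (\<Union>n\<in>{m..}. H n)"
  have "conn S \<F> U"
    unfolding U_def using H by (intro conn_chain) auto
  moreover have "U \<noteq> {}"
    unfolding U_def using nonempty by auto
  moreover have "U \<subseteq> N - X"
    unfolding U_def using H m by auto
  ultimately obtain C where C: "C \<in> comps S \<F> (N - X)" "U \<subseteq> C"
    using ex_comps_superset by blast
  have "N - C \<subseteq> (\<Union>n\<in>{..<m}. H n)"
  proof
    fix y assume y: "y \<in> N - C"
    then obtain n where n: "y \<in> H n"
      using H(3) by auto
    then have "n < m"
      using y C(2) unfolding U_def by (metis DiffD2 UN_I atLeast_iff not_le subsetD)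
    then show "y \<in> (\<Union>n\<in>{..<m}. H n)"
      using n by blast
  qed
  then have "finite (N - C)"
    using H(1) by (meson finite_UN_I finite_lessThan finite_subset)
  moreover have "D = C" if D: "D \<in> comps S \<F> (N - X)" "finite (N - D)" for D
  proof -
    have "C \<inter> D \<noteq> {}"
    proof
      assume "C \<inter> D = {}"
      then have "N \<subseteq> (N - C) \<union> (N - D)"
        by blast
      then show False
        using inf D(2) \<open>finite (N - C)\<close> finite_subset by blast
    qed
    then show ?thesis
      using comps_eq C D by blast
  qed
  ultimately have "tail S \<F> X N = C"
    unfolding tail_def using C(1) by (intro the_equality conjI) blast+
  then show "tail S \<F> X N \<in> comps S \<F> (N - X)" "finite (N - tail S \<F> X N)"
    using C \<open>finite (N - C)\<close> by auto
qed

text \<open>The one property of \<open>endK\<close> used later. The tail of \<open>N\<close> is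
  cofinite in \<open>N\<close>, so \<open>K\<close> meets it, and the component of
  \<open>S - X\<close> containing the tail absorbs \<open>K\<close>.\<close>

lemma necklace_end:
  assumes N: "necklace S \<F> N"
  obtains \<omega> where "\<omega> \<in> ends S \<F>"
    "\<And>X K. finite X \<Longrightarrow> X \<subseteq> S \<Longrightarrow> conn S \<F> K \<Longrightarrow> K \<inter> X = {} \<Longrightarrow> infinite (K \<inter> N) \<Longrightarrow> K \<subseteq> endK S \<F> X \<omega>"
proof
  define \<omega> where "\<omega> = {N'. necklace S \<F> N' \<and> neck_equiv S \<F> N N'}"
  show "\<omega> \<in> ends S \<F>"
    unfolding \<omega>_def ends_def using N by blast
  have NS: "N \<subseteq> S"
    using N unfolding necklace_def conn_def by blast
  have ex: "\<exists>K\<in>comps S \<F> (S - X). tail S \<F> X N \<subseteq> K" if "finite X" for X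
    using necklace_tail(1)[OF N that] NS comps_conn comps_subset comps_nonempty
    by (intro ex_comps_superset) blast+
  then have "neck_equiv S \<F> N N"
    unfolding neck_equiv_def by blast
  then have "N \<in> \<omega>"
    unfolding \<omega>_def using N by blast
  fix X K
  assume X: "finite X" "X \<subseteq> S" and K: "conn S \<F> K" "K \<inter> X = {}" "infinite (K \<inter> N)"
  obtain L where L: "L \<in> comps S \<F> (S - X)" "tail S \<F> X N \<subseteq> L"
    using ex X by blast
  have ne: "tail S \<F> X N \<noteq> {}"
    using necklace_tail(1)[OF N X(1)] comps_nonempty by blast
  \<comment> \<open>The nonempty tail of \<open>N\<close> determines its component \<open>L\<close>,
    so equivalence to \<open>N\<close> forces every tail of a necklace in \<open>\<omega>\<close>
    into the same \<open>L\<close>.\<close>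
  have uniq: "M = L" if "M \<in> comps S \<F> (S - X)" "tail S \<F> X N \<subseteq> M" for M
    using comps_eq[OF that(1) L(1)] that(2) L(2) ne by blast
  have "tail S \<F> X N' \<subseteq> L" if "N' \<in> \<omega>" for N'
    using that X uniq unfolding \<omega>_def neck_equiv_def by blast
  then have "endK S \<F> X \<omega> = L"
    unfolding endK_def using L(1) uniq \<open>N \<in> \<omega>\<close> by (intro the_equality conjI ballI) blast+
  moreover have "K \<inter> tail S \<F> X N \<noteq> {}"
  proof
    assume "K \<inter> tail S \<F> X N = {}"
    then have "K \<inter> N \<subseteq> N - tail S \<F> X N"
      by blast
    then show False
      using K(3) necklace_tail(2)[OF N X(1)] finite_subset by blast
  qed
  ultimately show "K \<subseteq> endK S \<F> X \<omega>"
    using comps_absorb[OF L(1) K(1)] K(2) L(2) conn_subset[OF K(1)] by blast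
qed

section \<open>Decreasing sequences of connected sets\<close>

text \<open>\<open>C\<close> is the current connected set, \<open>A\<close> collects the points removed so far and \<open>Z\<close> the points
  of \<open>C\<close> removed next. A free choice of \<open>Q\<close> lets the caller control the individual steps.\<close>

lemma nested_sequence_end:
  assumes conn_B: "\<And>C. B C \<Longrightarrow> conn S \<F> C"
    and step: "\<And>C A. B C \<Longrightarrow> finite A \<Longrightarrow> A \<inter> C \<noteq> {} \<Longrightarrow>
      \<exists>Z C'. finite Z \<and> A \<inter> C \<subseteq> Z \<and> Z \<subseteq> C \<and> B C' \<and> C' \<noteq> {} \<and> C' \<subseteq> C - Z \<and> Q C A Z C'"
    and "B C0" "C0 \<noteq> {}"
  obtains C A Z \<omega> where "C 0 = C0" "\<And>n. B (C n)" "\<And>n. A n \<inter> C n \<noteq> {}"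
    "\<And>n. A n \<union> Z n \<subseteq> A (Suc n)" "\<And>n. C (Suc n) \<subseteq> C n - Z n" "\<And>n. Q (C n) (A n) (Z n) (C (Suc n))"
    "\<omega> \<in> ends S \<F>"
    "\<And>X n. finite X \<Longrightarrow> X \<subseteq> S \<Longrightarrow> X \<inter> C n \<subseteq> \<Inter>(range C) \<Longrightarrow>
       \<exists>K\<in>comps S \<F> (C n - X). Z n \<subseteq> K \<and> K \<subseteq> endK S \<F> X \<omega>"
proof -
  define P where "P n s \<longleftrightarrow> B (fst s) \<and> finite (snd s) \<and> snd s \<inter> fst s \<noteq> {} \<and> (n = 0 \<longrightarrow> fst s = C0)"
    for n :: nat and s :: "'a set \<times> 'a set"
  \<comment> \<open>\<open>G\<close> is the next link of the necklace: it contains \<open>Z\<close>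
    and reaches into \<open>C'\<close>. Putting all of \<open>G\<close> into \<open>A'\<close> makes
    the next step remove the part of \<open>G\<close> in \<open>C'\<close>.\<close>
  define R where "R C A C' A' Z G \<longleftrightarrow> A \<inter> C \<subseteq> Z \<and> Z \<subseteq> G \<and> G \<subseteq> C \<and> finite G \<and> conn S \<F> G \<and>
      C' \<subseteq> C - Z \<and> G \<inter> C' \<noteq> {} \<and> A' = A \<union> G \<and> Q C A Z C'" for C A C' A' Z G
  have "\<exists>s. \<forall>n. P n (s n) \<and> (\<exists>Z G. R (fst (s n)) (snd (s n)) (fst (s (Suc n))) (snd (s (Suc n))) Z G)"
  proof (rule dependent_nat_choice)
    obtain x where "x \<in> C0"
      using assms(4) by blast
    then show "\<exists>s. P 0 s"
      using assms(3) by (intro exI[of _ "(C0, {x})"]) (simp add: P_def)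
  next
    fix s n assume s: "P n s"
    obtain C A where CA: "s = (C, A)"
      by (cases s)
    have C: "B C" "finite A" "A \<inter> C \<noteq> {}"
      using s unfolding CA P_def by auto
    from step[OF this] obtain Z C' where Z: "finite Z" "A \<inter> C \<subseteq> Z" "Z \<subseteq> C" "B C'" "C' \<noteq> {}"
        "C' \<subseteq> C - Z" "Q C A Z C'"
      by (elim exE conjE)
    obtain x where x: "x \<in> C'"
      using Z(5) by blast
    obtain G where G: "finite G" "conn S \<F> G" "insert x Z \<subseteq> G" "G \<subseteq> C"
      using finite_conn_superset[OF conn_B[OF C(1)], of "insert x Z"] Z x by blast
    have "P (Suc n) (C', A \<union> G)"
      unfolding P_def using Z C G x by auto
    moreover have "R C A C' (A \<union> G) Z G"
      unfolding R_def using Z G x by blast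
    ultimately show "\<exists>s'. P (Suc n) s' \<and> (\<exists>Z G. R (fst s) (snd s) (fst s') (snd s') Z G)"
      unfolding CA by (intro exI[of _ "(C', A \<union> G)"]) auto
  qed
  then obtain s where s: "\<And>n. P n (s n)"
      "\<And>n. \<exists>Z G. R (fst (s n)) (snd (s n)) (fst (s (Suc n))) (snd (s (Suc n))) Z G"
    by blast
  define C where "C n = fst (s n)" for n
  define A where "A n = snd (s n)" for n
  have P: "B (C n)" "finite (A n)" "A n \<inter> C n \<noteq> {}" for n
    using s(1)[of n] unfolding P_def C_def A_def by auto
  have C0: "C 0 = C0"
    using s(1)[of 0] unfolding P_def C_def by auto
  obtain Z G where ZG: "\<And>n. R (C n) (A n) (C (Suc n)) (A (Suc n)) (Z n) (G n)"
    using s(2) unfolding C_def A_def by metis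
  have R: "A n \<inter> C n \<subseteq> Z n" "Z n \<subseteq> G n" "G n \<subseteq> C n" "finite (G n)" "conn S \<F> (G n)"
    "C (Suc n) \<subseteq> C n - Z n" "G n \<inter> C (Suc n) \<noteq> {}" "A (Suc n) = A n \<union> G n"
    "Q (C n) (A n) (Z n) (C (Suc n))" for n
    using ZG[of n] unfolding R_def by blast+
  have "C (Suc n) \<subseteq> C n" for n
    using R(6)[of n] by blast
  then have mono: "C m \<subseteq> C n" if "n \<le> m" for m n
    using that by (rule lift_Suc_antimono_le)
  \<comment> \<open>A point of \<open>G n\<close> in \<open>C (Suc n)\<close> belongs to
    \<open>A (Suc n)\<close>, hence to \<open>Z (Suc n)\<close> and to the next link.\<close>
  have consecutive: "G n \<inter> G (Suc n) \<noteq> {}" for n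
    using R(1)[of "Suc n"] R(2)[of "Suc n"] R(7,8)[of n] by blast
  \<comment> \<open>What is left of \<open>G n\<close> in \<open>C (Suc n)\<close> lies in
    \<open>Z (Suc n)\<close> and is gone in \<open>C (n + 2)\<close>; hence links two or more apart
    are disjoint.\<close>
  have avoid: "G n \<inter> C m = {}" if "n + 2 \<le> m" for m n
  proof -
    have "G n \<inter> C (Suc (Suc n)) = {}"
      using R(1)[of "Suc n"] R(6)[of "Suc n"] R(8)[of n] by blast
    then show ?thesis
      using mono[of "Suc (Suc n)" m] that by auto
  qed
  have nonadjacent: "G n \<inter> G m = {}" if "n + 2 \<le> m" for m n
    using avoid[OF that] R(3)[of m] by blast
  have G_iff: "G i \<inter> G j \<noteq> {} \<longleftrightarrow> i \<le> j + 1 \<and> j \<le> i + 1" for i j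
  proof
    assume ne: "G i \<inter> G j \<noteq> {}"
    show "i \<le> j + 1 \<and> j \<le> i + 1"
      using nonadjacent[of i j] nonadjacent[of j i] ne by (metis Int_commute add_2_eq_Suc' Suc_eq_plus1 not_less_eq_eq)
  next
    assume "i \<le> j + 1 \<and> j \<le> i + 1"
    then consider "i = j" | "j = Suc i" | "i = Suc j"
      by linarith
    then show "G i \<inter> G j \<noteq> {}"
      using consecutive[of i] consecutive[of j] by cases auto
  qed
  define N where "N = (\<Union>n. G n)"
  have "conn S \<F> N"
    using conn_chain[of G 0, OF R(5) consecutive] unfolding N_def by (simp add: atLeast_0)
  then have N: "necklace S \<F> N"
    unfolding necklace_def using R(4,5) N_def G_iff by (intro conjI exI[of _ G] allI)
  then obtain \<omega> where \<omega>: "\<omega> \<in> ends S \<F>"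
    "\<And>X K. finite X \<Longrightarrow> X \<subseteq> S \<Longrightarrow> conn S \<F> K \<Longrightarrow> K \<inter> X = {} \<Longrightarrow> infinite (K \<inter> N) \<Longrightarrow> K \<subseteq> endK S \<F> X \<omega>"
    using necklace_end by blast
  show thesis
  proof (rule that[of C A Z \<omega>])
    fix X n
    assume X: "finite X" "X \<subseteq> S" "X \<inter> C n \<subseteq> \<Inter>(range C)"
    \<comment> \<open>The links from \<open>n\<close> on form a connected set. Each of them misses
      some later set, so \<open>T\<close> avoids \<open>\<Inter>(range C)\<close>, which contains
      the part of \<open>X\<close> in \<open>C n\<close>.\<close>
    define T where "T = (\<Union>k\<in>{n..}. G k)"
    have "conn S \<F> T"
      unfolding T_def by (rule conn_chain[of G, OF R(5) consecutive])
    moreover have "G n \<subseteq> T"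
      unfolding T_def by auto
    moreover have "T \<subseteq> C n - X"
    proof
      fix y assume "y \<in> T"
      then obtain k where k: "n \<le> k" "y \<in> G k"
        unfolding T_def by auto
      have "y \<in> C n"
        using k R(3)[of k] mono[of n k] by blast
      moreover have "y \<notin> C (k + 2)"
        using k avoid[of k "k + 2"] by blast
      ultimately show "y \<in> C n - X"
        using X(3) by blast
    qed
    moreover have "T \<noteq> {}"
      using \<open>G n \<subseteq> T\<close> R(7)[of n] by blast
    ultimately obtain K where K: "K \<in> comps S \<F> (C n - X)" "T \<subseteq> K"
      using ex_comps_superset by blast
    have "N - T \<subseteq> (\<Union>k\<in>{..<n}. G k)"
    proof
      fix y assume y: "y \<in> N - T"
      then obtain k where k: "y \<in> G k"
        unfolding N_def by blast
      then have "\<not> n \<le> k"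
        using y unfolding T_def by auto
      then show "y \<in> (\<Union>k\<in>{..<n}. G k)"
        using k by auto
    qed
    then have "finite (N - T)"
      using R(4) by (meson finite_UN_I finite_lessThan finite_subset)
    moreover have "infinite N"
      using necklace_tail(3)[OF N, of "{}"] by simp
    moreover have "N = (N - T) \<union> T"
      unfolding N_def T_def by auto
    ultimately have "infinite T"
      by (metis finite_UnI)
    moreover have "T \<subseteq> K \<inter> N"
      using K(2) unfolding N_def T_def by auto
    ultimately have "infinite (K \<inter> N)"
      using finite_subset by blast
    moreover have "K \<inter> X = {}"
      using comps_subset[OF K(1)] by blast
    ultimately have "K \<subseteq> endK S \<F> X \<omega>"
      using \<omega>(2) X comps_conn[OF K(1)] by blast
    then show "\<exists>K\<in>comps S \<F> (C n - X). Z n \<subseteq> K \<and> K \<subseteq> endK S \<F> X \<omega>"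
      using K R(2)[of n] \<open>G n \<subseteq> T\<close> by (intro bexI[of _ K] conjI) auto
  next
    show "A n \<union> Z n \<subseteq> A (Suc n)" for n
      using R(2,8)[of n] by blast
  qed (fact C0 P R \<omega>)+
qed

end

section \<open>Dismantling by removing single points\<close>

text \<open>Being inductive makes the removal process well-founded: no infinite ascending chain of
  removed points can arise, which is the source of raylessness.\<close>

inductive dismantlable :: "'a set \<Rightarrow> 'a set set \<Rightarrow> 'a set set \<Rightarrow> 'a set \<Rightarrow> bool"
  for S \<F> \<K> where
  covered: "K \<in> \<K> \<Longrightarrow> C \<subseteq> K \<Longrightarrow> dismantlable S \<F> \<K> C"
| remove: "x \<in> C \<Longrightarrow> (\<And>D. D \<in> comps S \<F> (C - {x}) \<Longrightarrow> dismantlable S \<F> \<K> D) \<Longrightarrow>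
    dismantlable S \<F> \<K> C"

context connectoid_on
begin

text \<open>The points of \<open>Y\<close> are removed one at a time: rule \<open>remove\<close>,
  read contrapositively, leaves a non-dismantlable component whenever the point lies in the current
  set.\<close>

lemma not_dismantlable_avoid_finite:
  assumes "conn S \<F> C" "C \<noteq> {}" "\<not> dismantlable S \<F> \<K> C" "finite Y"
  shows "\<exists>D\<subseteq>C - Y. conn S \<F> D \<and> D \<noteq> {} \<and> \<not> dismantlable S \<F> \<K> D"
  using assms(4)
proof (induction Y)
  case empty
  then show ?case
    using assms by blast
next
  case (insert y Y)
  then obtain D where D: "D \<subseteq> C - Y" "conn S \<F> D" "D \<noteq> {}" "\<not> dismantlable S \<F> \<K> D"
    by blast
  show ?case
  proof (cases "y \<in> D")
    case False
    then show ?thesis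
      using D by (intro exI[of _ D]) auto
  next
    case True
    then obtain E where "E \<in> comps S \<F> (D - {y})" "\<not> dismantlable S \<F> \<K> E"
      using D(4) dismantlable.remove by metis
    then show ?thesis
      using D(1) comps_conn comps_subset[of E "D - {y}"] comps_nonempty
      by (intro exI[of _ E]) blast
  qed
qed

text \<open>\<open>nested_sequence_end\<close> is used twice. If every bad set violates the
  separation property, the violations drive a sequence whose end refutes them; otherwise a bad set
  with the property starts a sequence with empty intersection.\<close>

lemma dismantlable_endK:
  assumes X: "\<forall>\<omega>\<in>ends S \<F>. finite (X \<omega>) \<and> X \<omega> \<subseteq> S"
    and "conn S \<F> U" "U \<noteq> {}"
  shows "dismantlable S \<F> {endK S \<F> (X \<omega>) \<omega> | \<omega>. \<omega> \<in> ends S \<F>} U"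
proof (rule ccontr)
  define \<K> where "\<K> = {endK S \<F> (X \<omega>) \<omega> | \<omega>. \<omega> \<in> ends S \<F>}"
  define B where "B C \<longleftrightarrow> conn S \<F> C \<and> C \<noteq> {} \<and> \<not> dismantlable S \<F> \<K> C" for C
  define sep where "sep C Z D \<longleftrightarrow> (\<exists>Y K. finite Y \<and> Y \<subseteq> D \<and> K \<in> comps S \<F> (C - Y) \<and> Z \<subseteq> K \<and>
      (\<exists>L\<in>\<K>. K \<subseteq> L))" for C Z D
  assume "\<not> dismantlable S \<F> {endK S \<F> (X \<omega>) \<omega> | \<omega>. \<omega> \<in> ends S \<F>} U"
  then have U: "B U" "U \<noteq> {}"
    using assms unfolding B_def \<K>_def by blast+
  have B_conn: "B C \<Longrightarrow> conn S \<F> C" and B_nonempty: "B C \<Longrightarrow> C \<noteq> {}" for C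
    unfolding B_def by blast+
  have B_avoid: "\<exists>D\<subseteq>C - Y. B D" if "B C" "finite Y" for C Y
    using not_dismantlable_avoid_finite that unfolding B_def by blast
  have B_uncovered: "\<not> C \<subseteq> L" if "B C" "L \<in> \<K>" for C L
    using that dismantlable.covered unfolding B_def by metis
  \<comment> \<open>Contrapositively, a failure of \<open>sep\<close> survives enlarging
    \<open>Z\<close> and shrinking \<open>D\<close>, so \<open>A \<inter> C\<close> can be added to
    \<open>Z\<close>.\<close>
  have sep_mono: "sep C Z D" if "sep C Z' D'" "Z \<subseteq> Z'" "D' \<subseteq> D" for C Z D Z' D'
    using that unfolding sep_def by (meson subset_trans)
  have "\<exists>C. B C \<and> (\<forall>Z D. finite Z \<longrightarrow> Z \<subseteq> C \<longrightarrow> B D \<longrightarrow> D \<subseteq> C - Z \<longrightarrow> sep C Z D)"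
  proof (rule ccontr)
    assume neg: "\<not> ?thesis"
    have step: "\<exists>Z D. finite Z \<and> A \<inter> C \<subseteq> Z \<and> Z \<subseteq> C \<and> B D \<and> D \<noteq> {} \<and> D \<subseteq> C - Z \<and> \<not> sep C Z D"
      if C: "B C" "finite A" "A \<inter> C \<noteq> {}" for C A
    proof -
      have "\<not> (\<forall>Z D. finite Z \<longrightarrow> Z \<subseteq> C \<longrightarrow> B D \<longrightarrow> D \<subseteq> C - Z \<longrightarrow> sep C Z D)"
        using neg C(1) by blast
      then obtain Z D where Z: "finite Z" "Z \<subseteq> C" "B D" "D \<subseteq> C - Z" "\<not> sep C Z D"
        by (simp only: not_all not_imp) (elim exE conjE, rule that)
      obtain E where E: "E \<subseteq> D - (Z \<union> (A \<inter> C))" "B E"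
        using B_avoid[OF Z(3), of "Z \<union> (A \<inter> C)"] Z(1) C(2) by auto
      have "\<not> sep C (Z \<union> (A \<inter> C)) E"
        using Z(5) sep_mono E(1) by blast
      then show ?thesis
        using Z E C(2) B_nonempty[OF E(2)] by (intro exI[of _ "Z \<union> (A \<inter> C)"] exI[of _ E]) auto
    qed
    obtain C A Z \<omega> where "C 0 = U" "\<And>n. B (C n)" "\<And>n. A n \<inter> C n \<noteq> {}"
      "\<And>n. A n \<union> Z n \<subseteq> A (Suc n)" and seq: "\<And>n. C (Suc n) \<subseteq> C n - Z n"
      "\<And>n. \<not> sep (C n) (Z n) (C (Suc n))" "\<omega> \<in> ends S \<F>"
      "\<And>X n. finite X \<Longrightarrow> X \<subseteq> S \<Longrightarrow> X \<inter> C n \<subseteq> \<Inter>(range C) \<Longrightarrow>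
         \<exists>K\<in>comps S \<F> (C n - X). Z n \<subseteq> K \<and> K \<subseteq> endK S \<F> X \<omega>"
    proof (rule nested_sequence_end[of B "\<lambda>C A Z D. \<not> sep C Z D" U, OF B_conn step U])
      fix C A Z \<omega>
      assume "C 0 = U" "\<And>n. B (C n)" "\<And>n. A n \<inter> C n \<noteq> {}"
        "\<And>n. A n \<union> Z n \<subseteq> A (Suc n)" "\<And>n. C (Suc n) \<subseteq> C n - Z n"
        "\<And>n. \<not> sep (C n) (Z n) (C (Suc n))" "\<omega> \<in> ends S \<F>"
        "\<And>X n. finite X \<Longrightarrow> X \<subseteq> S \<Longrightarrow> X \<inter> C n \<subseteq> \<Inter>(range C) \<Longrightarrow>
           \<exists>K\<in>comps S \<F> (C n - X). Z n \<subseteq> K \<and> K \<subseteq> endK S \<F> X \<omega>"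
      from that[OF this] show thesis .
    qed
    have Xw: "finite (X \<omega>)" "X \<omega> \<subseteq> S"
      using X seq(3) by blast+
    have "C (Suc n) \<subseteq> C n" for n
      using seq(1)[of n] by blast
    then obtain n where n: "X \<omega> \<inter> C n \<subseteq> \<Inter>(range C)"
      using decreasing_eventually_Inter[OF Xw(1), of C] by blast
    obtain K where K: "K \<in> comps S \<F> (C n - X \<omega>)" "Z n \<subseteq> K" "K \<subseteq> endK S \<F> (X \<omega>) \<omega>"
      using seq(4)[OF Xw n] by blast
    \<comment> \<open>The separator is \<open>X \<omega> \<inter> C n\<close>, which lies in the
      intersection and hence in \<open>C (Suc n)\<close>.\<close>
    have "sep (C n) (Z n) (C (Suc n))"
      unfolding sep_def
    proof (intro exI conjI bexI)
      show "finite (X \<omega> \<inter> C n)"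
        using Xw by blast
      show "X \<omega> \<inter> C n \<subseteq> C (Suc n)"
        using n by blast
      have "C n - X \<omega> \<inter> C n = C n - X \<omega>"
        by blast
      then show "K \<in> comps S \<F> (C n - X \<omega> \<inter> C n)"
        using K(1) by simp
      show "endK S \<F> (X \<omega>) \<omega> \<in> \<K>"
        unfolding \<K>_def using seq(3) by blast
    qed (use K in auto)
    then show False
      using seq(2) by blast
  qed
  then obtain C0 where C0: "B C0"
    and sep: "\<And>Z D. finite Z \<Longrightarrow> Z \<subseteq> C0 \<Longrightarrow> B D \<Longrightarrow> D \<subseteq> C0 - Z \<Longrightarrow> sep C0 Z D"
    by blast
  \<comment> \<open>Staying inside \<open>C0\<close> lets its separation property apply at every
    stage.\<close>
  define B' where "B' C \<longleftrightarrow> B C \<and> C \<subseteq> C0" for C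
  \<comment> \<open>The guarantee of a step: a connected set in \<open>C0\<close> that meets the
    collected points \<open>A\<close> must use a new point of \<open>Z\<close> to reach the next set
    \<open>D\<close>.\<close>
  define Q where "Q C A Z D \<longleftrightarrow> (\<forall>F. conn S \<F> F \<longrightarrow> F \<subseteq> C0 \<longrightarrow> F \<inter> Z \<subseteq> A \<longrightarrow> F \<inter> A \<noteq> {} \<longrightarrow> F \<inter> D = {})"
    for C A Z D :: "'a set"
  have step: "\<exists>Z D. finite Z \<and> A \<inter> C \<subseteq> Z \<and> Z \<subseteq> C \<and> B' D \<and> D \<noteq> {} \<and> D \<subseteq> C - Z \<and> Q C A Z D"
    if C: "B' C" "finite A" "A \<inter> C \<noteq> {}" for C A
  proof -
    have BC: "B C" "C \<subseteq> C0"
      using C(1) unfolding B'_def by auto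
    obtain D where D: "D \<subseteq> C - A" "B D"
      using B_avoid[OF BC(1) C(2)] by blast
    \<comment> \<open>All collected points of \<open>C0\<close> are separated, not only those still
      in \<open>C\<close>, so connections through discarded parts of \<open>C0\<close> are blocked
      too.\<close>
    obtain Y K L where Y: "finite Y" "Y \<subseteq> D" "K \<in> comps S \<F> (C0 - Y)" "A \<inter> C0 \<subseteq> K" "L \<in> \<K>" "K \<subseteq> L"
      using sep[of "A \<inter> C0" D] C(2) D BC unfolding sep_def by blast
    obtain E where E: "E \<subseteq> D - Y" "B E"
      using B_avoid[OF D(2) Y(1)] by blast
    have "K \<inter> E = {}"
    proof (rule ccontr)
      assume "K \<inter> E \<noteq> {}"
      then have "E \<subseteq> K"
        using comps_absorb[OF Y(3) B_conn[OF E(2)]] E(1) D(1) BC(2) by blast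
      then show False
        using B_uncovered[OF E(2) Y(5)] Y(6) by blast
    qed
    \<comment> \<open>The next removed set is \<open>A \<inter> C\<close> together with the
      separator. As \<open>Y\<close> is disjoint from \<open>A\<close>, an \<open>F\<close> without
      new points misses \<open>Y\<close> and stays in \<open>K\<close>, away from
      \<open>E\<close>.\<close>
    then have "Q C A (A \<inter> C \<union> Y) E"
      unfolding Q_def
    proof (intro allI impI)
      fix F assume F: "conn S \<F> F" "F \<subseteq> C0" "F \<inter> (A \<inter> C \<union> Y) \<subseteq> A" "F \<inter> A \<noteq> {}"
      have "F \<inter> Y = {}"
        using F(3) Y(2) D(1) by blast
      then have "F \<subseteq> K"
        using comps_absorb[OF Y(3) F(1)] F(2,4) Y(4) by blast
      then show "F \<inter> E = {}"
        using \<open>K \<inter> E = {}\<close> by blast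
    qed
    moreover have "A \<inter> C \<union> Y \<subseteq> C" "E \<subseteq> C - (A \<inter> C \<union> Y)" "finite (A \<inter> C \<union> Y)" "B' E"
      unfolding B'_def using Y D E BC C(2) by auto
    ultimately show ?thesis
      using B_nonempty[OF E(2)] by blast
  qed
  have "B' C0"
    unfolding B'_def using C0 by blast
  have B'_conn: "B' C \<Longrightarrow> conn S \<F> C" for C
    unfolding B'_def using B_conn by blast
  obtain C A Z \<omega> where seq: "C 0 = C0" "\<And>n. B' (C n)" "\<And>n. A n \<inter> C n \<noteq> {}"
    and seq': "\<And>n. A n \<union> Z n \<subseteq> A (Suc n)" "\<And>n. C (Suc n) \<subseteq> C n - Z n" "\<And>n. Q (C n) (A n) (Z n) (C (Suc n))"
    "\<omega> \<in> ends S \<F>"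
    "\<And>X n. finite X \<Longrightarrow> X \<subseteq> S \<Longrightarrow> X \<inter> C n \<subseteq> \<Inter>(range C) \<Longrightarrow>
       \<exists>K\<in>comps S \<F> (C n - X). Z n \<subseteq> K \<and> K \<subseteq> endK S \<F> X \<omega>"
  proof (rule nested_sequence_end[of B' Q C0, OF B'_conn step \<open>B' C0\<close> B_nonempty[OF C0]])
    fix C A Z \<omega>
    assume "C 0 = C0" "\<And>n. B' (C n)" "\<And>n. A n \<inter> C n \<noteq> {}"
        "\<And>n. A n \<union> Z n \<subseteq> A (Suc n)" "\<And>n. C (Suc n) \<subseteq> C n - Z n"
        "\<And>n. Q (C n) (A n) (Z n) (C (Suc n))" "\<omega> \<in> ends S \<F>"
        "\<And>X n. finite X \<Longrightarrow> X \<subseteq> S \<Longrightarrow> X \<inter> C n \<subseteq> \<Inter>(range C) \<Longrightarrow>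
           \<exists>K\<in>comps S \<F> (C n - X). Z n \<subseteq> K \<and> K \<subseteq> endK S \<F> X \<omega>"
    from that[OF this] show thesis .
  qed
  have A_mono: "A m \<subseteq> A n" if "m \<le> n" for m n
  proof (rule lift_Suc_mono_le[of A, OF _ that])
    show "A n \<subseteq> A (Suc n)" for n
      using seq'(1)[of n] by blast
  qed
  have Inter: "\<Inter>(range C) = {}"
  proof (rule ccontr)
    assume "\<Inter>(range C) \<noteq> {}"
    then obtain y where y: "\<And>n. y \<in> C n"
      by blast
    obtain x where x: "x \<in> A 0" "x \<in> C0"
      using seq(1,3) by (metis disjoint_iff)
    obtain F where F: "finite F" "conn S \<F> F" "F \<subseteq> C0" "x \<in> F" "y \<in> F"
      using conn_obtain[OF B_conn[OF C0] x(2)] y[of 0] seq(1) by metis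
    have "\<exists>n. z \<in> \<Union>(range A) \<longrightarrow> z \<in> A n" for z
      by blast
    then obtain f where f: "\<And>z. z \<in> \<Union>(range A) \<longrightarrow> z \<in> A (f z)"
      by metis
    \<comment> \<open>Every point of \<open>F\<close> that is ever collected is in
      \<open>A m\<close>, so \<open>F\<close> has no new point in \<open>Z m\<close>, and
      \<open>Q\<close> keeps it away from \<open>C (Suc m)\<close>, although \<open>y\<close> lies
      in both.\<close>
    define m where "m = Max (f ` F)"
    have "F \<inter> \<Union>(range A) \<subseteq> A m"
    proof
      fix z assume z: "z \<in> F \<inter> \<Union>(range A)"
      then have "f z \<le> m"
        unfolding m_def using F(1) by simp
      then show "z \<in> A m"
        using f z A_mono by blast
    qed
    then have "F \<inter> Z m \<subseteq> A m"
      using seq'(1)[of m] by blast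
    moreover have "F \<inter> A m \<noteq> {}"
      using F(4) x(1) A_mono[of 0 m] by blast
    ultimately have "F \<inter> C (Suc m) = {}"
      using seq'(3)[of m] F(2,3) unfolding Q_def by blast
    then show False
      using F(5) y by blast
  qed
  have Xw: "finite (X \<omega>)" "X \<omega> \<subseteq> S"
    using X seq'(4) by blast+
  have "C (Suc n) \<subseteq> C n" for n
    using seq'(2)[of n] by blast
  then obtain n where n: "X \<omega> \<inter> C n \<subseteq> \<Inter>(range C)"
    using decreasing_eventually_Inter[OF Xw(1), of C] by blast
  obtain K where K: "K \<in> comps S \<F> (C n - X \<omega>)" "K \<subseteq> endK S \<F> (X \<omega>) \<omega>"
    using seq'(5)[OF Xw n] by blast
  \<comment> \<open>With empty intersection, \<open>X \<omega>\<close> no longer meets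
    \<open>C n\<close>, so the connected \<open>C n\<close> is absorbed by \<open>K\<close> and
    covered, against its badness.\<close>
  have "C n - X \<omega> = C n"
    using n Inter by blast
  then have "C n \<subseteq> K"
    using comps_absorb[OF K(1) B'_conn[OF seq(2)], of n] comps_subset[OF K(1)] comps_nonempty[OF K(1)] by auto
  moreover have "endK S \<F> (X \<omega>) \<omega> \<in> \<K>"
    unfolding \<K>_def using seq'(4) by blast
  ultimately show False
    using K(2) B_uncovered[of "C n"] seq(2)[of n] unfolding B'_def by blast
qed

end

section \<open>Graphs of tree orders\<close>

lemma is_path_snoc:
  assumes "is_path V E p" "v \<in> V" "v \<notin> set p" "{last p, v} \<in> E"
  shows "is_path V E (p @ [v])"
  unfolding is_path_def
proof (intro conjI allI impI)
  fix i assume i: "Suc i < length (p @ [v])"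
  have ne: "p \<noteq> []"
    using assms(1) unfolding is_path_def by blast
  show "{(p @ [v]) ! i, (p @ [v]) ! Suc i} \<in> E"
  proof (cases "Suc i < length p")
    case True
    then show ?thesis
      using assms(1) unfolding is_path_def by (simp add: nth_append)
  next
    case False
    then have "i = length p - 1" "i < length p"
      using i ne by auto
    then show ?thesis
      using assms(4) ne by (simp add: nth_append last_conv_nth)
  qed
qed (use assms in \<open>auto simp: is_path_def\<close>)

lemma is_path_prefix:
  assumes "is_path V E p" "v \<in> set p"
  obtains q where "is_path V E q" "hd q = hd p" "last q = v"
proof -
  obtain i where i: "i < length p" "p ! i = v"
    using assms(2) by (meson in_set_conv_nth)
  show thesis
  proof (rule that[of "take (Suc i) p"])
    show "is_path V E (take (Suc i) p)"
      using assms(1) i unfolding is_path_def by (auto dest: in_set_takeD)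
    show "last (take (Suc i) p) = v"
      using i by (simp add: take_Suc_conv_app_nth)
  qed simp
qed

lemma ex_path_of_rtrancl:
  assumes "(u, v) \<in> {(a, b). {a, b} \<in> E}\<^sup>*" "is_graph V E" "u \<in> V"
  shows "\<exists>p. is_path V E p \<and> hd p = u \<and> last p = v"
  using assms(1)
proof (induction rule: rtrancl_induct)
  case base
  then show ?case
    using assms(3) by (intro exI[of _ "[u]"]) (simp add: is_path_def)
next
  case (step v w)
  then obtain p where p: "is_path V E p" "hd p = u" "last p = v"
    by blast
  show ?case
  proof (cases "w \<in> set p")
    case True
    then show ?thesis
      using is_path_prefix[OF p(1)] p(2) by metis
  next
    case False
    have "w \<in> V"
      using step(2) assms(2) unfolding is_graph_def by (auto simp: doubleton_eq_iff)
    then have "is_path V E (p @ [w])"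
      using is_path_snoc[OF p(1)] False step(2) p(3) by simp
    moreover have "hd (p @ [w]) = u"
      using p unfolding is_path_def by simp
    ultimately show ?thesis
      by (intro exI[of _ "p @ [w]"]) simp
  qed
qed

text \<open>A rooted tree seen as an order: the down-set of every vertex is a finite chain starting
  at \<open>r\<close>. \<open>tree_le_edges\<close> recovers \<open>le\<close> as the tree order of
  the Hasse diagram \<open>edges\<close>.\<close>

locale tree_order =
  fixes V :: "'a set" and le :: "'a \<Rightarrow> 'a \<Rightarrow> bool" and r :: 'a
  assumes le_in: "le u v \<Longrightarrow> u \<in> V \<and> v \<in> V"
    and le_refl: "v \<in> V \<Longrightarrow> le v v"
    and le_antisym: "le u v \<Longrightarrow> le v u \<Longrightarrow> u = v"
    and le_trans: "le u v \<Longrightarrow> le v w \<Longrightarrow> le u w"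
    and root_in: "r \<in> V"
    and root_le: "v \<in> V \<Longrightarrow> le r v"
    and finite_down: "finite {u. le u v}"
    and down_linear: "le u w \<Longrightarrow> le v w \<Longrightarrow> le u v \<or> le v u"
begin

definition cover :: "'a \<Rightarrow> 'a \<Rightarrow> bool" where
  "cover u v \<longleftrightarrow> le u v \<and> u \<noteq> v \<and> (\<forall>w. le u w \<longrightarrow> le w v \<longrightarrow> w = u \<or> w = v)"

definition edges :: "'a set set" where
  "edges = {{u, v} | u v. cover u v}"

definition height :: "'a \<Rightarrow> nat" where
  "height v = card {u. le u v}"

lemma height_mono:
  assumes "le u v" "u \<noteq> v"
  shows "height u < height v"
  unfolding height_def
proof (rule psubset_card_mono[OF finite_down])
  show "{w. le w u} \<subset> {w. le w v}"
    using assms le_trans le_antisym le_refl le_in by blast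
qed

lemma cover_le: "cover u v \<Longrightarrow> le u v"
  and cover_neq: "cover u v \<Longrightarrow> u \<noteq> v"
  by (simp_all add: cover_def)

lemma cover_below:
  assumes "cover u v" "le w v" "w \<noteq> v"
  shows "le w u"
  using assms down_linear unfolding cover_def by blast

lemma cover_unique:
  assumes "cover u w" "cover v w"
  shows "u = v"
  using assms cover_below cover_le cover_neq le_antisym by metis

lemma edge_iff: "{u, v} \<in> edges \<longleftrightarrow> cover u v \<or> cover v u"
  unfolding edges_def by (auto simp: doubleton_eq_iff)

lemma ex_cover:
  assumes "v \<in> V" "v \<noteq> r"
  obtains u where "cover u v"
proof -
  define D where "D = {u. le u v \<and> u \<noteq> v}"
  have D: "finite D" "r \<in> D"
    unfolding D_def using assms root_le finite_down[of v] by auto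
  define m where "m = Max (height ` D)"
  have "m \<in> height ` D"
    unfolding m_def using D by (intro Max_in) auto
  then obtain u where u: "u \<in> D" "height u = m"
    by blast
  have max: "height w \<le> height u" if "w \<in> D" for w
    unfolding u(2) m_def using that D by simp
  have "cover u v"
    unfolding cover_def
  proof (intro conjI allI impI)
    fix w assume w: "le u w" "le w v"
    show "w = u \<or> w = v"
      using max[of w] height_mono[of u w] w unfolding D_def by fastforce
  qed (use u D_def in auto)
  then show thesis
    by (rule that)
qed

lemma is_graph_edges: "is_graph V edges"
  unfolding is_graph_def edges_def using cover_le cover_neq le_in by blast

lemma path_from_root:
  "v \<in> V \<Longrightarrow> \<exists>p. is_path V edges p \<and> hd p = r \<and> last p = v \<and> set p = {u. le u v}"
proof (induction "height v" arbitrary: v rule: less_induct)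
  case less
  show ?case
  proof (cases "v = r")
    case True
    have "{u. le u r} = {r}"
      using root_in root_le le_antisym le_refl le_in by blast
    then show ?thesis
      using True root_in by (intro exI[of _ "[r]"]) (simp add: is_path_def)
  next
    case False
    then obtain u where u: "cover u v"
      using ex_cover less.prems by blast
    obtain p where p: "is_path V edges p" "hd p = r" "last p = u" "set p = {w. le w u}"
      using less.hyps[of u] height_mono[OF cover_le[OF u] cover_neq[OF u]] le_in[OF cover_le[OF u]] by blast
    have v: "v \<notin> set p"
      using p(4) u cover_le cover_neq le_antisym by blast
    have "{w. le w v} = insert v {w. le w u}"
      using cover_below[OF u] cover_le[OF u] le_trans le_refl[OF less.prems] by blast
    moreover have "is_path V edges (p @ [v])"
      using is_path_snoc[OF p(1) less.prems v] p(3) u by (simp add: edge_iff)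
    moreover have "hd (p @ [v]) = r"
      using p unfolding is_path_def by simp
    ultimately show ?thesis
      using p(4) by (intro exI[of _ "p @ [v]"]) simp
  qed
qed

text \<open>By \<open>cover_below\<close>, an edge entering the up-set of \<open>x\<close> from
  outside arrives at \<open>x\<close> itself, so a path from \<open>r\<close> avoiding
  \<open>x\<close> never gets above it.\<close>

lemma path_meets_down:
  assumes "is_path V edges p" "hd p = r" "le x (last p)"
  shows "x \<in> set p"
proof (rule ccontr)
  assume x: "x \<notin> set p"
  have p: "p \<noteq> []" and edge: "\<And>i. Suc i < length p \<Longrightarrow> {p ! i, p ! Suc i} \<in> edges"
    using assms(1) unfolding is_path_def by auto
  have "\<not> le x (p ! i)" if "i < length p" for i
    using that
  proof (induction i)
    case 0
    have "p ! 0 = r"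
      using assms(2) p by (simp add: hd_conv_nth)
    then show ?case
      using x p 0 root_le[of x] le_in le_antisym by (metis nth_mem)
  next
    case (Suc i)
    have ne: "p ! Suc i \<noteq> x" "p ! i \<noteq> x"
      using x Suc.prems by (metis nth_mem Suc_lessD)+
    show ?case
      using edge[OF Suc.prems] Suc ne cover_below[of "p ! i" "p ! Suc i" x]
        le_trans[of x "p ! Suc i" "p ! i"] cover_le[of "p ! Suc i" "p ! i"] Suc_lessD[OF Suc.prems]
      unfolding edge_iff by blast
  qed
  then show False
    using assms(3) p by (simp add: last_conv_nth)
qed

lemma tree_le_edges: "tree_le V edges r u v \<longleftrightarrow> le u v"
proof
  assume "tree_le V edges r u v"
  then show "le u v"
    using path_from_root[of v] unfolding tree_le_def by blast
next
  assume "le u v"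
  then show "tree_le V edges r u v"
    using path_meets_down le_in unfolding tree_le_def by blast
qed

text \<open>On a cycle, both neighbours of a vertex of maximal height are covered by it, hence equal
  by \<open>cover_unique\<close>.\<close>

lemma acyclic_edges:
  assumes "is_path V edges p" "3 \<le> length p" "{last p, hd p} \<in> edges"
  shows False
proof -
  define n where "n = length p"
  have n: "3 \<le> n" "p \<noteq> []"
    using assms(2) unfolding n_def by auto
  have edge: "{p ! i, p ! (Suc i mod n)} \<in> edges" if "i < n" for i
  proof (cases "Suc i < n")
    case True
    then show ?thesis
      using assms(1) unfolding is_path_def n_def by simp
  next
    case False
    then have "i = n - 1" "Suc i = n"
      using that by auto
    then show ?thesis
      using assms(3) n(2) unfolding n_def by (simp add: last_conv_nth hd_conv_nth)
  qed
  define m where "m = Max ((\<lambda>i. height (p ! i)) ` {..<n})"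
  have "m \<in> (\<lambda>i. height (p ! i)) ` {..<n}"
    unfolding m_def using n by (intro Max_in) (auto simp: lessThan_empty_iff)
  then obtain i where i: "i < n" "height (p ! i) = m"
    by blast
  have max: "height (p ! j) \<le> height (p ! i)" if "j < n" for j
    unfolding i(2) m_def using that by simp
  have covered: "cover (p ! j) (p ! i)" if "{p ! j, p ! i} \<in> edges" "j < n" for j
    using that max[of j] height_mono[of "p ! i" "p ! j"] cover_le cover_neq unfolding edge_iff by fastforce
  \<comment> \<open>\<open>j\<close> and \<open>k\<close> are the cyclic neighbours of
    \<open>i\<close>; they differ because \<open>n\<close> is at least 3.\<close>
  define j where "j = (if i = 0 then n - 1 else i - 1)"
  define k where "k = Suc i mod n"
  have j: "j < n" "Suc j mod n = i" and k: "k < n" and "j \<noteq> k"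
    using i n unfolding j_def k_def by (auto simp: mod_Suc)
  have "p ! j = p ! k"
    using edge[OF j(1)] edge[OF i(1)] j k unfolding k_def[symmetric]
    by (intro cover_unique[of _ "p ! i"] covered) (auto simp: insert_commute)
  then show False
    using assms(1) j(1) k \<open>j \<noteq> k\<close> unfolding is_path_def n_def by (simp add: nth_eq_iff_index_eq)
qed

lemma rooted_tree_edges: "rooted_tree V edges r"
  unfolding rooted_tree_def is_tree_def
proof (intro conjI ballI notI)
  have reach: "(r, v) \<in> {(a, b). {a, b} \<in> edges}\<^sup>*" if "v \<in> V" for v
    using that
  proof (induction "height v" arbitrary: v rule: less_induct)
    case less
    show ?case
    proof (cases "v = r")
      case False
      then obtain u where u: "cover u v"
        using ex_cover less.prems by blast
      have "(r, u) \<in> {(a, b). {a, b} \<in> edges}\<^sup>*"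
        using less.hyps[of u] height_mono[OF cover_le[OF u] cover_neq[OF u]] le_in[OF cover_le[OF u]] by blast
      moreover have "(u, v) \<in> {(a, b). {a, b} \<in> edges}"
        using u by (simp add: edge_iff)
      ultimately show ?thesis
        by (rule rtrancl_into_rtrancl)
    qed simp
  qed
  have sym: "sym ({(a, b). {a, b} \<in> edges}\<^sup>*)"
    by (intro sym_rtrancl symI) (simp add: insert_commute)
  fix u v assume "u \<in> V" "v \<in> V"
  then show "\<exists>p. is_path V edges p \<and> hd p = u \<and> last p = v"
    using reach symD[OF sym] is_graph_edges by (intro ex_path_of_rtrancl) (meson rtrancl_trans)+
next
  assume "\<exists>p. is_path V edges p \<and> 3 \<le> length p \<and> {last p, hd p} \<in> edges"
  then show False
    using acyclic_edges by blast
qed (use is_graph_edges root_in in auto)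

text \<open>A ray that goes up once goes up forever, since turning down would repeat the unique
  predecessor; this gives a forbidden chain. A ray that never goes up has strictly falling
  heights.\<close>

lemma rayless_edges:
  assumes "\<nexists>f :: nat \<Rightarrow> 'a. \<forall>n. le (f n) (f (Suc n)) \<and> f n \<noteq> f (Suc n)"
  shows "rayless V edges"
  unfolding rayless_def
proof
  assume "\<exists>R. is_ray V edges R"
  then obtain R where R: "inj R" "\<And>n. {R n, R (Suc n)} \<in> edges"
    unfolding is_ray_def by blast
  have up: "cover (R (Suc n)) (R (Suc (Suc n)))" if "cover (R n) (R (Suc n))" for n
  proof (rule ccontr)
    assume "\<not> ?thesis"
    then have "cover (R (Suc (Suc n))) (R (Suc n))"
      using R(2)[of "Suc n"] unfolding edge_iff by blast
    then have "R n = R (Suc (Suc n))"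
      using cover_unique that by blast
    then show False
      using R(1) by (simp add: inj_eq)
  qed
  show False
  proof (cases "\<exists>n. cover (R n) (R (Suc n))")
    case True
    then obtain n where n: "cover (R n) (R (Suc n))"
      by blast
    have "cover (R (n + k)) (R (Suc (n + k)))" for k
      by (induction k) (use n up in auto)
    then have "\<forall>k. le (R (n + k)) (R (n + Suc k)) \<and> R (n + k) \<noteq> R (n + Suc k)"
      using cover_le cover_neq by simp
    then have "\<exists>f. \<forall>k. le (f k) (f (Suc k)) \<and> f k \<noteq> f (Suc k)"
      by (rule exI[of _ "\<lambda>k. R (n + k)"])
    then show False
      using assms by contradiction
  next
    case False
    then have down: "cover (R (Suc n)) (R n)" for n
      using R(2)[of n] unfolding edge_iff by blast
    have "height (R n) + n \<le> height (R 0)" for n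
    proof (induction n)
      case (Suc n)
      then show ?case
        using height_mono[OF cover_le cover_neq, OF down[of n] down[of n]] by linarith
    qed simp
    from this[of "Suc (height (R 0))"] show False
      by simp
  qed
qed

end

section \<open>Normal orders\<close>

context connectoid_on
begin

text \<open>The tree order of a rayless normal tree inside \<open>C\<close>, without its root: removing the root
  from such an order leaves orders of the same kind on the components.\<close>

definition normal_order :: "'a set set \<Rightarrow> 'a set \<Rightarrow> 'a set \<Rightarrow> ('a \<Rightarrow> 'a \<Rightarrow> bool) \<Rightarrow> bool" where
  "normal_order \<K> C V le \<longleftrightarrow> V \<subseteq> C \<and>
     (\<forall>u v. le u v \<longrightarrow> u \<in> V \<and> v \<in> V) \<and>
     (\<forall>v\<in>V. le v v) \<and>
     (\<forall>u v. le u v \<longrightarrow> le v u \<longrightarrow> u = v) \<and>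
     (\<forall>u v w. le u v \<longrightarrow> le v w \<longrightarrow> le u w) \<and>
     (\<forall>v. finite {u. le u v}) \<and>
     (\<forall>u v w. le u w \<longrightarrow> le v w \<longrightarrow> le u v \<or> le v u) \<and>
     (\<nexists>f :: nat \<Rightarrow> 'a. \<forall>n. le (f n) (f (Suc n)) \<and> f n \<noteq> f (Suc n)) \<and>
     (\<forall>D u v. conn S \<F> D \<longrightarrow> D \<subseteq> C \<longrightarrow> u \<in> D \<inter> V \<longrightarrow> v \<in> D \<inter> V \<longrightarrow> \<not> le u v \<longrightarrow> \<not> le v u \<longrightarrow>
        (\<exists>w\<in>D. le w u \<and> le w v)) \<and>
     (\<forall>u v. le u v \<longrightarrow>
        (\<exists>D. conn S \<F> D \<and> D \<subseteq> C \<and> u \<in> D \<and> v \<in> D \<and> (\<forall>w\<in>D. le w u \<longrightarrow> w = u))) \<and>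
     (\<forall>D. conn S \<F> D \<longrightarrow> D \<noteq> {} \<longrightarrow> D \<subseteq> C - V \<longrightarrow> (\<exists>K\<in>\<K>. D \<subseteq> K))"

lemma normal_orderD:
  assumes "normal_order \<K> C V le"
  shows "V \<subseteq> C"
    and "le u v \<Longrightarrow> u \<in> V \<and> v \<in> V"
    and "v \<in> V \<Longrightarrow> le v v"
    and "le u v \<Longrightarrow> le v u \<Longrightarrow> u = v"
    and "le u v \<Longrightarrow> le v w \<Longrightarrow> le u w"
    and "finite {u. le u v}"
    and "le u w \<Longrightarrow> le v w \<Longrightarrow> le u v \<or> le v u"
    and "\<nexists>f :: nat \<Rightarrow> 'a. \<forall>n. le (f n) (f (Suc n)) \<and> f n \<noteq> f (Suc n)"
    and "conn S \<F> D \<Longrightarrow> D \<subseteq> C \<Longrightarrow> u \<in> D \<inter> V \<Longrightarrow> v \<in> D \<inter> V \<Longrightarrow> \<not> le u v \<Longrightarrow> \<not> le v u \<Longrightarrow>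
        \<exists>w\<in>D. le w u \<and> le w v"
    and "le u v \<Longrightarrow> \<exists>D. conn S \<F> D \<and> D \<subseteq> C \<and> u \<in> D \<and> v \<in> D \<and> (\<forall>w\<in>D. le w u \<longrightarrow> w = u)"
    and "conn S \<F> D \<Longrightarrow> D \<noteq> {} \<Longrightarrow> D \<subseteq> C - V \<Longrightarrow> \<exists>K\<in>\<K>. D \<subseteq> K"
  using assms unfolding normal_order_def by simp_all

text \<open>The orders on the components are put side by side above \<open>x\<close>. A connected
  set avoiding \<open>x\<close> lies in one component and inherits the conditions there; in a set
  containing \<open>x\<close>, this root is a common lower bound.\<close>

lemma normal_order_add_root:
  assumes C: "conn S \<F> C" and x: "x \<in> C"
    and ex: "\<And>D. D \<in> comps S \<F> (C - {x}) \<Longrightarrow> \<exists>V le. normal_order \<K> D V le"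
  obtains V le where "normal_order \<K> C V le" "x \<in> V" "\<And>v. v \<in> V \<Longrightarrow> le x v"
proof -
  define \<D> where "\<D> = comps S \<F> (C - {x})"
  obtain W l where no: "\<And>D. D \<in> \<D> \<Longrightarrow> normal_order \<K> D (W D) (l D)"
    using ex unfolding \<D>_def by metis
  note l = normal_orderD[OF no]
  define V where "V = insert x (\<Union>D\<in>\<D>. W D)"
  define le where "le u v \<longleftrightarrow> u = x \<and> v \<in> V \<or> (\<exists>D\<in>\<D>. l D u v)" for u v
  have sub: "D \<subseteq> C - {x}" if "D \<in> \<D>" for D
    using that comps_subset unfolding \<D>_def by blast
  have same: "D = E" if "D \<in> \<D>" "E \<in> \<D>" "v \<in> D" "v \<in> E" for D E v
    using that comps_eq unfolding \<D>_def by blast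
  have inside: "\<exists>E\<in>\<D>. D \<subseteq> E" if "conn S \<F> D" "D \<noteq> {}" "D \<subseteq> C - {x}" for D
    using that ex_comps_superset unfolding \<D>_def by blast
  have l_in: "u \<in> W D" "v \<in> W D" "u \<in> D" "v \<in> D" if "D \<in> \<D>" "l D u v" for D u v
    using l(1,2)[OF that(1)] that(2) by blast+
  have V_cases: "v = x \<or> (\<exists>D\<in>\<D>. v \<in> W D \<and> v \<in> D)" if "v \<in> V" for v
    using that l(1) unfolding V_def by blast
  have V_D: "v \<in> V \<longleftrightarrow> v \<in> W D" if "D \<in> \<D>" "v \<in> D" for v D
    using that same l(1) sub[OF that(1)] unfolding V_def by blast
  have le_x: "le u x \<longleftrightarrow> u = x" for u
    using l_in sub unfolding le_def V_def by blast
  have x_le: "le x v" if "v \<in> V" for v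
    using that unfolding le_def by blast
  \<comment> \<open>Components are disjoint, so for a point of \<open>D\<close> only
    \<open>l D\<close> contributes to its comparisons, apart from \<open>x\<close> below.\<close>
  have le_above: "le u v \<longleftrightarrow> u = x \<and> v \<in> W D \<or> l D u v" if "D \<in> \<D>" "v \<in> D" for u v D
  proof -
    have "(\<exists>E\<in>\<D>. l E u v) \<longleftrightarrow> l D u v"
      using that same[OF _ that(1) _ that(2)] l_in(4) by metis
    then show ?thesis
      using V_D[OF that] unfolding le_def by simp
  qed
  have le_below: "le u v \<longleftrightarrow> l D u v" if "D \<in> \<D>" "u \<in> D" for u v D
  proof -
    have "(\<exists>E\<in>\<D>. l E u v) \<longleftrightarrow> l D u v"
      using that same[OF _ that(1) _ that(2)] l_in(3) by metis
    moreover have "u \<noteq> x"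
      using that sub by blast
    ultimately show ?thesis
      unfolding le_def by simp
  qed
  have "normal_order \<K> C V le"
    unfolding normal_order_def
  proof (intro conjI allI ballI impI)
    show "V \<subseteq> C"
      using x sub l(1) unfolding V_def by blast
    show le_V: "u \<in> V" "v \<in> V" if uv: "le u v" for u v
    proof -
      consider "u = x" "v \<in> V" | D where "D \<in> \<D>" "l D u v"
        using uv unfolding le_def by blast
      then have "u \<in> V \<and> v \<in> V"
      proof cases
        case 1
        then show ?thesis
          unfolding V_def by blast
      next
        case (2 D)
        then show ?thesis
          using l_in(1,2)[OF 2] unfolding V_def by blast
      qed
      then show "u \<in> V" "v \<in> V"
        by blast+
    qed
    show "le v v" if "v \<in> V" for v
      using V_cases[OF that] l(3) x_le[OF that] unfolding le_def by blast
    show "u = v" if "le u v" "le v u" for u v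
      using V_cases[OF le_V(2)[OF that(1)]]
    proof
      assume "v = x"
      then show ?thesis
        using that le_x by simp
    next
      assume "\<exists>D\<in>\<D>. v \<in> W D \<and> v \<in> D"
      then obtain D where D: "D \<in> \<D>" "v \<in> D"
        by blast
      have "l D v u"
        using that(2) le_below[OF D] by blast
      then show ?thesis
        using that(1) le_below[OF D(1) l_in(4)[OF D(1)]] l(4)[OF D(1)] by blast
    qed
    show "le u w" if "le u v" "le v w" for u v w
      using V_cases[OF le_V(2)[OF that(1)]]
    proof
      assume "v = x"
      then show ?thesis
        using that le_x by simp
    next
      assume "\<exists>D\<in>\<D>. v \<in> W D \<and> v \<in> D"
      then obtain D where D: "D \<in> \<D>" "v \<in> D"
        by blast
      have vw: "l D v w"
        using that(2) le_below[OF D] by blast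
      show ?thesis
        using that(1) le_above[OF D] le_V(2)[OF that(2)] l(5)[OF D(1) _ vw] D(1)
        unfolding le_def[of u w] by blast
    qed
    show "finite {u. le u v}" for v
    proof (cases "\<exists>D\<in>\<D>. v \<in> D")
      case True
      then obtain D where D: "D \<in> \<D>" "v \<in> D"
        by blast
      have "{u. le u v} \<subseteq> insert x {u. l D u v}"
        using le_above[OF D] by blast
      then show ?thesis
        using l(6)[OF D(1)] finite_subset by blast
    next
      case False
      then have "u = x" if "le u v" for u
        using that l_in(4) unfolding le_def by metis
      then have "{u. le u v} \<subseteq> {x}"
        by blast
      then show ?thesis
        using finite_subset by blast
    qed
    show "le u v \<or> le v u" if "le u w" "le v w" for u v w
      using V_cases[OF le_V(2)[OF that(1)]]
    proof
      assume "w = x"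
      then show ?thesis
        using that le_x x_le V_def by auto
    next
      assume "\<exists>D\<in>\<D>. w \<in> W D \<and> w \<in> D"
      then obtain D where D: "D \<in> \<D>" "w \<in> D"
        by blast
      show ?thesis
      proof (cases "u = x \<or> v = x")
        case True
        then show ?thesis
          using x_le le_V(1) that by blast
      next
        case False
        then have "l D u w" "l D v w"
          using that le_above[OF D] by blast+
        then show ?thesis
          using l(7)[OF D(1)] D(1) unfolding le_def by blast
      qed
    qed
    show "\<nexists>f :: nat \<Rightarrow> 'a. \<forall>n. le (f n) (f (Suc n)) \<and> f n \<noteq> f (Suc n)"
    proof
      assume "\<exists>f :: nat \<Rightarrow> 'a. \<forall>n. le (f n) (f (Suc n)) \<and> f n \<noteq> f (Suc n)"
      then obtain f :: "nat \<Rightarrow> 'a" where f: "\<And>n. le (f n) (f (Suc n))" "\<And>n. f n \<noteq> f (Suc n)"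
        by blast
      \<comment> \<open>The chain may start at \<open>x\<close> but cannot return to it, so from
        index 1 on it stays in one component.\<close>
      have "f (Suc 0) \<noteq> x"
        using f[of 0] le_x by metis
      then obtain D where D: "D \<in> \<D>" "f (Suc 0) \<in> D"
        using V_cases le_V(2) f(1) by metis
      have fD: "f (Suc n) \<in> D" for n
      proof (induction n)
        case (Suc n)
        then show ?case
          using le_below[OF D(1) Suc] f(1)[of "Suc n"] l_in(4)[OF D(1)] by blast
      qed (rule D(2))
      have "\<forall>n. l D (f (Suc n)) (f (Suc (Suc n))) \<and> f (Suc n) \<noteq> f (Suc (Suc n))"
        using fD le_below[OF D(1)] f by blast
      then have "\<exists>g. \<forall>n. l D (g n) (g (Suc n)) \<and> g n \<noteq> g (Suc n)"
        by (rule exI[of _ "\<lambda>n. f (Suc n)"])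
      then show False
        using l(8)[OF D(1)] by contradiction
    qed
    show "\<exists>w\<in>D. le w u \<and> le w v"
      if D: "conn S \<F> D" "D \<subseteq> C" and uv: "u \<in> D \<inter> V" "v \<in> D \<inter> V" "\<not> le u v" "\<not> le v u" for D u v
    proof (cases "x \<in> D")
      case True
      then show ?thesis
        using x_le uv by blast
    next
      case False
      then obtain E where E: "E \<in> \<D>" "D \<subseteq> E"
        using inside[OF D(1)] D(2) uv(1) by blast
      have "u \<in> D \<inter> W E" "v \<in> D \<inter> W E" "\<not> l E u v" "\<not> l E v u"
        using uv E V_D[OF E(1)] unfolding le_def by blast+
      then obtain w where "w \<in> D" "l E w u" "l E w v"
        using l(9)[OF E(1) D(1) E(2)] by blast
      then show ?thesis
        using E(1) unfolding le_def by blast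
    qed
    show "\<exists>D. conn S \<F> D \<and> D \<subseteq> C \<and> u \<in> D \<and> v \<in> D \<and> (\<forall>w\<in>D. le w u \<longrightarrow> w = u)" if uv: "le u v" for u v
    proof (cases "u = x")
      case True
      then show ?thesis
        using C x le_x le_V(2)[OF uv] \<open>V \<subseteq> C\<close> by (intro exI[of _ C]) blast
    next
      case False
      then obtain E where E: "E \<in> \<D>" "u \<in> E"
        using V_cases le_V(1)[OF uv] by blast
      obtain D where D: "conn S \<F> D" "D \<subseteq> E" "u \<in> D" "v \<in> D" "\<forall>w\<in>D. l E w u \<longrightarrow> w = u"
        using l(10)[OF E(1)] uv le_below[OF E] by blast
      have "\<forall>w\<in>D. le w u \<longrightarrow> w = u"
        using D(2,5) le_below[OF E(1)] by blast
      then show ?thesis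
        using D sub[OF E(1)] by (intro exI[of _ D]) blast
    qed
    show "\<exists>K\<in>\<K>. D \<subseteq> K" if D: "conn S \<F> D" "D \<noteq> {}" "D \<subseteq> C - V" for D
    proof -
      have "D \<subseteq> C - {x}"
        using D(3) unfolding V_def by blast
      then obtain E where E: "E \<in> \<D>" "D \<subseteq> E"
        using inside D by blast
      then have "D \<subseteq> E - W E"
        using D(3) unfolding V_def by blast
      then show ?thesis
        using l(11)[OF E(1) D(1,2)] by blast
    qed
  qed
  then show thesis
    using that[of V le] x_le V_def by blast
qed

lemma ex_normal_order:
  assumes "dismantlable S \<F> \<K> C" "conn S \<F> C"
  shows "\<exists>V le. normal_order \<K> C V le"
  using assms
proof (induction rule: dismantlable.induct)
  case (covered K C)
  then have "\<exists>K\<in>\<K>. D \<subseteq> K" if "D \<subseteq> C" for D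
    using that by blast
  \<comment> \<open>A covered set is left whole; the empty order is admissible because
    \<open>normal_order\<close> demands no root.\<close>
  then have "normal_order \<K> C {} (\<lambda>_ _. False)"
    unfolding normal_order_def by simp
  then show ?case
    by blast
next
  case (remove x C)
  then show ?case
    using normal_order_add_root[of C x \<K>] comps_conn by metis
qed

end

section \<open>From dismantlability of \<open>S\<close> to a rayless normal tree\<close>

theorem theorem1p3:
  fixes S :: "'a set" and \<F> :: "'a set set" and X :: "'a set set \<Rightarrow> 'a set"
  assumes "connectoid S \<F>"
    and "S \<noteq> {}"
    and "connected_connectoid S \<F>"
    and "\<forall>\<omega>\<in>ends S \<F>. finite (X \<omega>) \<and> X \<omega> \<subseteq> S"
  shows "\<exists>V E r. normal_tree S \<F> V E r \<and> rayless V E \<and>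
           (\<forall>D\<in>comps S \<F> (S - V). \<exists>K\<in>{endK S \<F> (X \<omega>) \<omega> | \<omega>. \<omega> \<in> ends S \<F>}. D \<subseteq> K)"
proof -
  interpret connectoid_on S \<F>
    by unfold_locales (rule assms(1))
  define \<K> where "\<K> = {endK S \<F> (X \<omega>) \<omega> | \<omega>. \<omega> \<in> ends S \<F>}"
  have S: "conn S \<F> S"
    using assms(3) unfolding connected_connectoid_def .
  have dis: "dismantlable S \<F> \<K> S"
    unfolding \<K>_def by (rule dismantlable_endK[OF assms(4) S assms(2)])
  \<comment> \<open>The tree needs a root, so a point is removed even if \<open>S\<close> itself is
    covered; subsets of a covered set are covered as well.\<close>
  have "\<exists>r\<in>S. \<forall>D\<in>comps S \<F> (S - {r}). dismantlable S \<F> \<K> D"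
    using dis
  proof cases
    case (covered K)
    have "dismantlable S \<F> \<K> D" if "D \<in> comps S \<F> (S - {r})" for D r
      using comps_subset[OF that] covered by (intro dismantlable.covered) blast+
    then show ?thesis
      using assms(2) by blast
  qed blast
  then obtain r where r: "r \<in> S" "\<And>D. D \<in> comps S \<F> (S - {r}) \<Longrightarrow> dismantlable S \<F> \<K> D"
    by blast
  obtain V le where no: "normal_order \<K> S V le" "r \<in> V" "\<And>v. v \<in> V \<Longrightarrow> le r v"
    using normal_order_add_root[OF S r(1), of \<K>] ex_normal_order r(2) comps_conn by metis
  note N = normal_orderD[OF no(1)]
  interpret tree_order V le r
    by unfold_locales (use N(2-7) no(2,3) in blast)+
  have rayless: "rayless V edges"
    by (rule rayless_edges[OF N(8)])
  have "weak_normal_tree S \<F> V edges r"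
    unfolding weak_normal_tree_def tree_le_edges down_open_def
  proof (intro conjI allI impI ballI)
    show "rooted_tree V edges r"
      by (rule rooted_tree_edges)
    show "V \<subseteq> S"
      by (rule N(1))
    show "\<exists>w\<in>C. le w u \<and> le w v"
      if "conn S \<F> C" "u \<in> C \<inter> V" "v \<in> C \<inter> V" "\<not> le u v \<and> \<not> le v u" for C u v
      using N(9)[OF that(1) conn_subset[OF that(1)] that(2,3)] that(4) by blast
    show "\<exists>C. conn S \<F> C \<and> u \<in> C \<and> v \<in> C \<and> C \<inter> {x \<in> V. le x u \<and> x \<noteq> u} = {}" if "le u v" for u v
      using N(10)[OF that] by blast
  qed
  \<comment> \<open>The necklace condition concerns rays, and there are none.\<close>
  then have "normal_tree S \<F> V edges r"
    using rayless unfolding normal_tree_def rayless_def by blast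
  moreover have "\<exists>K\<in>\<K>. D \<subseteq> K" if "D \<in> comps S \<F> (S - V)" for D
    using N(11) comps_conn[OF that] comps_nonempty[OF that] comps_subset[OF that] by blast
  ultimately show ?thesis
    using rayless unfolding \<K>_def by blast
qed

end
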